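(* Let $0<\rho<1$ be fixed. For all sufficiently large $n$ (depending on $\rho$), every $n$-vertex $C_8$-free graph $G$ satisfies \[ \sum_{T\in\triangle(\tilde G)}|P_T|\le n+O_\rho(1). \]
   Context: All graphs are finite, simple and undirected; a graph is $C_8$-free if it has no (not necessarily induced) subgraph isomorphic to the 8-cycle. For distinct vertices $u,v$ of $G$, $N_G(u,v)=N_G(u)\cap N_G(v)$ is the set of common neighbors and $d(u,v)=|N_G(u,v)|$. $\tilde G=\tilde G_{\rho n}$ is the graph on $V(G)$ whose edges are the pairs $uv$ of distinct vertices with $d(u,v)\ge\rho n$. $\triangle(\tilde G)$ is the set of triangles of $\tilde G$ (3-sets of vertices that are pairwise adjacent in $\tilde G$). For $T=\{a,b,c\}\in\triangle(\tilde G)$, $P_T:=N_G(a,b)\cup N_G(b,c)\cup N_G(c,a)$. $O_\rho(1)$ denotes a quantity bounded by a constant depending only on $\rho$ (not on $n$ or $G$). *)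

theory Defs
  imports Complex_Main "Graph_Theory.Graph_Theory"
begin

text \<open>
  A finite simple undirected graph is a \<^locale>\<open>pair_graph\<close>: a finite, loop-free, symmetric
  digraph whose arcs are pairs of vertices, so that the edge \<open>uv\<close> is the pair of arcs
  \<open>(u, v)\<close>, \<open>(v, u)\<close>.
\<close>

text \<open>A simple graph only for \<open>k \<ge> 3\<close>.\<close>

definition cycle_graph :: "nat \<Rightarrow> nat pair_pre_digraph" where
  "cycle_graph k =
     \<lparr> pverts = {..<k},
       parcs = {(i, j). i < k \<and> j < k \<and> (j = (i + 1) mod k \<or> i = (j + 1) mod k)} \<rparr>"

text \<open>
  The copy \<open>H\<close> need not be induced. It is automatically a symmetric digraph, being isomorphic
  to one.
\<close>

definition cycle_free :: "nat \<Rightarrow> 'a pair_pre_digraph \<Rightarrow> bool" where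
  "cycle_free k G \<longleftrightarrow>
     \<not> (\<exists>H. subgraph H (with_proj G) \<and> digraph_iso H (with_proj (cycle_graph k)))"

definition nbrs :: "'a pair_pre_digraph \<Rightarrow> 'a \<Rightarrow> 'a set" where
  "nbrs G u = {w \<in> pverts G. (u, w) \<in> parcs G}"

definition common_nbrs :: "'a pair_pre_digraph \<Rightarrow> 'a \<Rightarrow> 'a \<Rightarrow> 'a set" where
  "common_nbrs G u v = nbrs G u \<inter> nbrs G v"

definition codegree :: "'a pair_pre_digraph \<Rightarrow> 'a \<Rightarrow> 'a \<Rightarrow> nat" where
  "codegree G u v = card (common_nbrs G u v)"

text \<open>The graph usually written \<open>G\<close> with a tilde and subscript \<open>t\<close>.\<close>

definition codegree_graph :: "real \<Rightarrow> 'a pair_pre_digraph \<Rightarrow> 'a pair_pre_digraph" where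
  "codegree_graph t G =
     \<lparr> pverts = pverts G,
       parcs = {(u, v). u \<in> pverts G \<and> v \<in> pverts G \<and> u \<noteq> v \<and> real (codegree G u v) \<ge> t} \<rparr>"

definition triangles :: "'a pair_pre_digraph \<Rightarrow> 'a set set" where
  "triangles G =
     {T. T \<subseteq> pverts G \<and> card T = 3 \<and> (\<forall>u\<in>T. \<forall>v\<in>T. u \<noteq> v \<longrightarrow> (u, v) \<in> parcs G)}"

text \<open>
  For \<open>T = {a, b, c}\<close> with \<open>a\<close>, \<open>b\<close>, \<open>c\<close> distinct this is
  \<open>N(a, b) \<union> N(b, c) \<union> N(c, a)\<close>.
\<close>

definition pair_nbrs :: "'a pair_pre_digraph \<Rightarrow> 'a set \<Rightarrow> 'a set" where
  "pair_nbrs G T = \<Union> {common_nbrs G u v | u v. u \<in> T \<and> v \<in> T \<and> u \<noteq> v}"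

end

theory Submission
  imports Defs
begin

text \<open>
  A walk in the codegree graph can be subdivided by distinct midpoints, since every edge has
  linearly many common neighbours to choose from. Hence a 4-cycle whose sides are codegree-graph
  edges, or pairs with a prescribed common neighbour, becomes an 8-cycle of the graph. It follows
  that two distinct triangles \<open>T\<close>, \<open>T'\<close> of the codegree graph share at most one vertex, and that
  common neighbourhoods of a side of \<open>T\<close> and a side of \<open>T'\<close> meet in at most one vertex, so their
  \<open>P\<close>-sets meet in boundedly many. As every \<open>P\<^sub>T\<close> has at least \<open>\<rho>n\<close> elements,
  inclusion-exclusion bounds the number of triangles by a constant \<open>M\<close>, and then bounds the sum
  of the sizes by \<open>n + O(M\<^sup>2)\<close>.
\<close>

section \<open>Sums of sizes of almost disjoint sets\<close>

lemma card_sum_le_card_Union: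
  assumes "finite I" and "\<And>i. i \<in> I \<Longrightarrow> finite (A i)"
    and "\<And>i j. i \<in> I \<Longrightarrow> j \<in> I \<Longrightarrow> i \<noteq> j \<Longrightarrow> card (A i \<inter> A j) \<le> k"
  shows "(\<Sum>i\<in>I. card (A i)) \<le> card (\<Union>i\<in>I. A i) + k * (card I)\<^sup>2"
  using assms
proof (induction I rule: finite_induct)
  case empty
  then show ?case by simp
next
  case (insert x I)
  let ?U = "\<Union>i\<in>I. A i"
  have IH: "(\<Sum>i\<in>I. card (A i)) \<le> card ?U + k * (card I)\<^sup>2"
    using insert.IH insert.prems by simp
  \<comment> \<open>The new set meets the old union in at most \<open>k\<close> elements per old
    set. These losses add up to about half of \<open>k * (card I)\<^sup>2\<close>, and the full
    square keeps the induction simple.\<close>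
  have "A x \<inter> ?U = (\<Union>i\<in>I. A x \<inter> A i)" by blast
  then have "card (A x \<inter> ?U) \<le> (\<Sum>i\<in>I. card (A x \<inter> A i))"
    using card_UN_le[OF insert.hyps(1), of "\<lambda>i. A x \<inter> A i"] by simp
  also have "\<dots> \<le> card I * k"
    using sum_bounded_above[of I "\<lambda>i. card (A x \<inter> A i)" k] insert.prems(2) insert.hyps(2)
    by fastforce
  finally have "card (A x \<inter> ?U) \<le> k * card I" by (simp add: mult.commute)
  moreover have "card (A x) + card ?U = card (A x \<union> ?U) + card (A x \<inter> ?U)"
    using insert.hyps(1) insert.prems(1) by (intro card_Un_Int) auto
  moreover have "k * (card I)\<^sup>2 + k * card I \<le> k * (Suc (card I))\<^sup>2"
    by (simp add: power2_eq_square algebra_simps)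
  ultimately show ?case
    using IH insert.hyps by simp
qed

section \<open>Sides of triangles and choice of midpoints\<close>

lemma common_nbrs_commute: "common_nbrs G u v = common_nbrs G v u"
  by (auto simp: common_nbrs_def)

lemma pair_nbrs_iff:
  "w \<in> pair_nbrs G T \<longleftrightarrow> (\<exists>u\<in>T. \<exists>v\<in>T. u \<noteq> v \<and> w \<in> common_nbrs G u v)"
  unfolding pair_nbrs_def by blast

lemma triangleE:
  assumes "T \<in> triangles G" "u \<in> T" "v \<in> T" "u \<noteq> v"
  obtains w where "T = {u, v, w}" "w \<noteq> u" "w \<noteq> v"
proof -
  have "card T = 3" using assms(1) by (simp add: triangles_def)
  then have "card (T - {u, v}) = 1"
    using assms(2-4) by (subst card_Diff_subset) auto
  then obtain w where "T - {u, v} = {w}" by (auto simp: card_1_singleton_iff)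
  then show ?thesis using assms(2,3) that[of w] by blast
qed

lemma triangleD:
  "T \<in> triangles G \<Longrightarrow> u \<in> T \<Longrightarrow> v \<in> T \<Longrightarrow> u \<noteq> v \<Longrightarrow> (u, v) \<in> parcs G"
  by (simp add: triangles_def)

lemma codegree_graph_sym:
  "(u, v) \<in> parcs (codegree_graph t G) \<Longrightarrow> (v, u) \<in> parcs (codegree_graph t G)"
  by (auto simp: codegree_graph_def codegree_def common_nbrs_commute)

lemma codegree_graph_le:
  "(u, v) \<in> parcs (codegree_graph t G) \<Longrightarrow> t \<le> real (card (common_nbrs G u v))"
  by (simp add: codegree_graph_def codegree_def)

text \<open>Here \<open>xs\<close> lists the vertices already in use, so that the midpoints of a
  cycle can be picked greedily, one after another.\<close>

lemma codegree_graph_midpoint: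
  assumes "(u, v) \<in> parcs (codegree_graph t G)" "real (length xs) < t"
  obtains m where "m \<in> common_nbrs G u v" "m \<notin> set xs"
proof -
  have "card (set xs) < card (common_nbrs G u v)"
    using codegree_graph_le[OF assms(1)] assms(2) card_length[of xs] by linarith
  then have "\<not> common_nbrs G u v \<subseteq> set xs"
    by (meson List.finite_set card_mono not_less)
  then show ?thesis using that by blast
qed

section \<open>Eight-cycles as subdivided 4-cycles\<close>

context pair_graph
begin

lemma parcs_sym: "(u, v) \<in> parcs G \<Longrightarrow> (v, u) \<in> parcs G"
  using pair_sym_arcs by (simp add: symmetric_def sym_def)

lemma common_nbrs_iff:
  "w \<in> common_nbrs G u v \<longleftrightarrow> (u, w) \<in> parcs G \<and> (w, v) \<in> parcs G"
  using parcs_sym in_arcsD2 by (auto simp: common_nbrs_def nbrs_def)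

lemma common_nbrs_neq:
  "w \<in> common_nbrs G u v \<Longrightarrow> w \<noteq> u \<and> w \<noteq> v"
  using pair_no_loops by (fastforce simp: common_nbrs_iff)

lemma pair_nbrs_subset: "pair_nbrs G T \<subseteq> pverts G"
  by (auto simp: pair_nbrs_def common_nbrs_def nbrs_def)

lemma finite_pair_nbrs: "finite (pair_nbrs G T)"
  using pair_nbrs_subset pair_finite_verts by (rule finite_subset)

text \<open>The image of the standard cycle under \<open>f\<close> is a forbidden copy. Later
  arguments therefore only need to list the vertices of a cycle in order.\<close>

lemma cycle_freeD:
  assumes "cycle_free k G" and inj: "inj_on f {..<k}"
    and arc: "\<And>i. i < k \<Longrightarrow> (f i, f ((i + 1) mod k)) \<in> parcs G"
  shows False
proof -
  let ?C = "with_proj (cycle_graph k)"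
  \<comment> \<open>Arcs are moved by applying \<open>f\<close> to both ends, and \<open>fst\<close>
    and \<open>snd\<close> stay tail and head, so the image consists of arcs of
    \<open>G\<close>.\<close>
  let ?h = "\<lparr>iso_verts = f, iso_arcs = map_prod f f, iso_head = snd, iso_tail = fst\<rparr>"
  have wf: "wf_digraph ?C"
    by unfold_locales (auto simp: cycle_graph_def)
  have "inj_on (map_prod f f) ({..<k} \<times> {..<k})"
    using inj by (intro map_prod_inj_on)
  then have "inj_on (map_prod f f) (arcs ?C)"
    by (rule inj_on_subset) (auto simp: cycle_graph_def)
  then have iso: "pre_digraph.digraph_isomorphism ?C ?h"
    using wf inj by (simp add: pre_digraph.digraph_isomorphism_def cycle_graph_def)
  then have "digraph_iso ?C (app_iso ?h ?C)"
    unfolding digraph_iso_def by blast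
  then have "digraph_iso (app_iso ?h ?C) ?C"
    by (rule digraph_iso_swap[OF wf])
  moreover have "subgraph (app_iso ?h ?C) (with_proj G)"
    unfolding subgraph_def
  proof (intro conjI)
    show "verts (app_iso ?h ?C) \<subseteq> verts (with_proj G)"
      using arc in_arcsD1 by (auto simp: cycle_graph_def)
    show "arcs (app_iso ?h ?C) \<subseteq> arcs (with_proj G)"
      using arc parcs_sym by (auto simp: cycle_graph_def)
    show "wf_digraph (with_proj G)" by (rule wf_digraph)
    show "wf_digraph (app_iso ?h ?C)"
      by (rule wf_digraph.wf_digraphI_app_iso[OF wf iso])
    show "compatible (with_proj G) (app_iso ?h ?C)"
      by (simp add: compatible_def)
  qed
  ultimately show False
    using assms(1) unfolding cycle_free_def by blast
qed

lemma no_subdivided_cycle4: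
  assumes "cycle_free 8 G"
    and "m\<^sub>1 \<in> common_nbrs G a b" "m\<^sub>2 \<in> common_nbrs G b c"
    and "m\<^sub>3 \<in> common_nbrs G c d" "m\<^sub>4 \<in> common_nbrs G d a"
    and "distinct [a, m\<^sub>1, b, m\<^sub>2, c, m\<^sub>3, d, m\<^sub>4]"
  shows False
proof (rule cycle_freeD[OF assms(1)])
  let ?xs = "[a, m\<^sub>1, b, m\<^sub>2, c, m\<^sub>3, d, m\<^sub>4]"
  show "inj_on ((!) ?xs) {..<8}"
    using assms(6) by (intro inj_on_nth) auto
  fix i :: nat
  assume "i < 8"
  then have "i \<in> {0, 1, 2, 3, 4, 5, 6, 7}" by auto
  then show "(?xs ! i, ?xs ! ((i + 1) mod 8)) \<in> parcs G"
    using assms(2-5) by (auto simp: common_nbrs_iff)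
qed

text \<open>The midpoints \<open>m\<close> and \<open>m'\<close> are prescribed, the other two are
  chosen freely. The last choice must avoid seven vertices, which is why 8 is enough for
  \<open>t\<close>.\<close>

lemma no_cycle4_two_links:
  assumes "cycle_free 8 G" "8 \<le> t"
    and "m \<in> common_nbrs G a b" "(b, c) \<in> parcs (codegree_graph t G)"
    and "m' \<in> common_nbrs G c d" "(d, a) \<in> parcs (codegree_graph t G)"
    and "distinct [a, b, c, d, m, m']"
  shows False
proof -
  obtain p where p: "p \<in> common_nbrs G b c" "p \<notin> set [a, b, c, d, m, m']"
    using codegree_graph_midpoint[OF assms(4), of "[a, b, c, d, m, m']"] assms(2) by auto
  obtain q where "q \<in> common_nbrs G d a" "q \<notin> set [a, b, c, d, m, m', p]"
    using codegree_graph_midpoint[OF assms(6), of "[a, b, c, d, m, m', p]"] assms(2) by auto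
  then show False
    using no_subdivided_cycle4[OF assms(1,3) p(1) assms(5), of q] p(2) assms(7) by auto
qed

lemma no_cycle4_one_link:
  assumes "cycle_free 8 G" "8 \<le> t"
    and "m \<in> common_nbrs G a b" "(b, c) \<in> parcs (codegree_graph t G)"
    and "(c, d) \<in> parcs (codegree_graph t G)" "(d, a) \<in> parcs (codegree_graph t G)"
    and "distinct [a, b, c, d, m]"
  shows False
proof -
  obtain m' where "m' \<in> common_nbrs G c d" "m' \<notin> set [a, b, c, d, m]"
    using codegree_graph_midpoint[OF assms(5), of "[a, b, c, d, m]"] assms(2) by auto
  then show False
    using no_cycle4_two_links[OF assms(1-4) _ assms(6)] assms(7) by auto
qed

lemma codegree_graph_no_cycle4:
  assumes "cycle_free 8 G" "8 \<le> t"
    and "(a, b) \<in> parcs (codegree_graph t G)" "(b, c) \<in> parcs (codegree_graph t G)"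
    and "(c, d) \<in> parcs (codegree_graph t G)" "(d, a) \<in> parcs (codegree_graph t G)"
    and "distinct [a, b, c, d]"
  shows False
proof -
  obtain m where "m \<in> common_nbrs G a b" "m \<notin> set [a, b, c, d]"
    using codegree_graph_midpoint[OF assms(3), of "[a, b, c, d]"] assms(2) by auto
  then show False
    using no_cycle4_one_link[OF assms(1,2) _ assms(4-6)] assms(7) by auto
qed

section \<open>Small intersections for distinct triangles\<close>

lemma triangles_share_at_most_one:
  assumes cf: "cycle_free 8 G" "8 \<le> t"
    and T: "T \<in> triangles (codegree_graph t G)" "T' \<in> triangles (codegree_graph t G)" "T \<noteq> T'"
    and uv: "u \<in> T" "u \<in> T'" "v \<in> T" "v \<in> T'"
  shows "u = v"
proof (rule ccontr)
  assume "u \<noteq> v"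
  obtain c where c: "T = {u, v, c}" "c \<noteq> u" "c \<noteq> v"
    using triangleE[OF T(1) uv(1,3) \<open>u \<noteq> v\<close>] .
  obtain d where d: "T' = {u, v, d}" "d \<noteq> u" "d \<noteq> v"
    using triangleE[OF T(2) uv(2,4) \<open>u \<noteq> v\<close>] .
  have "c \<noteq> d" using T(3) c d by blast
  \<comment> \<open>The two shared vertices and the two third vertices alternate on a 4-cycle of the
    codegree graph.\<close>
  show False
  proof (rule codegree_graph_no_cycle4[OF cf])
    show "(u, c) \<in> parcs (codegree_graph t G)" "(c, v) \<in> parcs (codegree_graph t G)"
      using triangleD[OF T(1)] c by auto
    show "(v, d) \<in> parcs (codegree_graph t G)" "(d, u) \<in> parcs (codegree_graph t G)"
      using triangleD[OF T(2)] d by auto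
    show "distinct [u, c, v, d]"
      using c d \<open>c \<noteq> d\<close> \<open>u \<noteq> v\<close> by auto
  qed
qed

text \<open>A vertex \<open>w\<close> in both sets is a midpoint of \<open>b\<close> and
  \<open>y\<close>. If \<open>w\<close> differs from the third vertex \<open>z\<close> of
  \<open>T'\<close>, the cycle \<open>b, y, z, a\<close> can be subdivided using \<open>w\<close>,
  so only \<open>z\<close> itself can survive.\<close>

lemma common_nbrs_Int_adjacent:
  assumes cf: "cycle_free 8 G" "8 \<le> t"
    and T: "T \<in> triangles (codegree_graph t G)" "T' \<in> triangles (codegree_graph t G)" "T \<noteq> T'"
    and "a \<in> T" "b \<in> T" "a \<noteq> b" "a \<in> T'" "y \<in> T'" "a \<noteq> y"
  shows "card (common_nbrs G a b \<inter> common_nbrs G a y) \<le> 1"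
proof -
  obtain z where z: "T' = {a, y, z}" "z \<noteq> a" "z \<noteq> y"
    using triangleE[OF T(2)] assms by metis
  have b: "b \<notin> T'"
    using triangles_share_at_most_one[OF cf T] assms by blast
  have "common_nbrs G a b \<inter> common_nbrs G a y \<subseteq> {z}"
  proof
    fix w
    assume w: "w \<in> common_nbrs G a b \<inter> common_nbrs G a y"
    show "w \<in> {z}"
    proof (rule ccontr)
      assume "w \<notin> {z}"
      show False
      proof (rule no_cycle4_one_link[OF cf])
        show "w \<in> common_nbrs G b y"
          using w by (auto simp: common_nbrs_def)
        show "(y, z) \<in> parcs (codegree_graph t G)" "(z, a) \<in> parcs (codegree_graph t G)"
          using triangleD[OF T(2)] z by auto
        show "(a, b) \<in> parcs (codegree_graph t G)"
          using triangleD[OF T(1)] assms by auto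
        show "distinct [b, y, z, a, w]"
          using z b assms w \<open>w \<notin> {z}\<close> common_nbrs_neq[of w] by auto
      qed
    qed
  qed
  then show ?thesis
    using card_mono[of "{z}"] by fastforce
qed

text \<open>Two vertices in the intersection would serve as midpoints of the crossing pairs
  \<open>a, x\<close> and \<open>y, b\<close>, and the two given edges close these up to the 4-cycle
  \<open>a, x, y, b\<close>.\<close>

lemma common_nbrs_Int_disjoint:
  assumes cf: "cycle_free 8 G" "8 \<le> t"
    and ab: "(a, b) \<in> parcs (codegree_graph t G)" "(x, y) \<in> parcs (codegree_graph t G)"
    and "distinct [a, b, x, y]"
  shows "card (common_nbrs G a b \<inter> common_nbrs G x y) \<le> 1"
proof -
  let ?I = "common_nbrs G a b \<inter> common_nbrs G x y"
  have "w = w'" if w: "w \<in> ?I" "w' \<in> ?I" for w w'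
  proof (rule ccontr)
    assume "w \<noteq> w'"
    show False
    proof (rule no_cycle4_two_links[OF cf _ ab(2) _ codegree_graph_sym[OF ab(1)]])
      show "w \<in> common_nbrs G a x" "w' \<in> common_nbrs G y b"
        using w by (auto simp: common_nbrs_def)
      show "distinct [a, x, y, b, w, w']"
        using assms(5) w \<open>w \<noteq> w'\<close> common_nbrs_neq[of w] common_nbrs_neq[of w'] by auto
    qed
  qed
  then have "is_singleton ?I \<or> ?I = {}"
    unfolding is_singleton_def by blast
  then show ?thesis
    by (auto simp: is_singleton_def)
qed

lemma common_nbrs_Int:
  assumes cf: "cycle_free 8 G" "8 \<le> t"
    and T: "T \<in> triangles (codegree_graph t G)" "T' \<in> triangles (codegree_graph t G)" "T \<noteq> T'"
    and a: "a \<in> T" "b \<in> T" "a \<noteq> b" "x \<in> T'" "y \<in> T'" "x \<noteq> y"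
  shows "card (common_nbrs G a b \<inter> common_nbrs G x y) \<le> 1"
proof -
  \<comment> \<open>If the sides share an endpoint, swapping the ends of one or both sides brings it
    to the front, where \<open>adj\<close> applies.\<close>
  note adj = common_nbrs_Int_adjacent[OF cf T]
  consider "distinct [a, b, x, y]" | "a = x" | "a = y" | "b = x" | "b = y"
    using a by auto
  then show ?thesis
  proof cases
    case 1
    then show ?thesis
      using common_nbrs_Int_disjoint[OF cf] triangleD[OF T(1)] triangleD[OF T(2)] a by blast
  next
    case 2
    then show ?thesis using adj[of a b y] a by simp
  next
    case 3
    then show ?thesis using adj[of a b x] a by (metis common_nbrs_commute)
  next
    case 4
    then show ?thesis using adj[of b a y] a by (metis common_nbrs_commute)
  next
    case 5
    then show ?thesis
      using adj[of b a x] a by (metis common_nbrs_commute)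
  qed
qed

lemma pair_nbrs_Int:
  assumes cf: "cycle_free 8 G" "8 \<le> t"
    and T: "T \<in> triangles (codegree_graph t G)" "T' \<in> triangles (codegree_graph t G)" "T \<noteq> T'"
  shows "card (pair_nbrs G T \<inter> pair_nbrs G T') \<le> 81"
proof -
  \<comment> \<open>Ordered pairs of distinct vertices stand for the sides. The crude count 9 per
    triangle gives 81 pairs of sides, each contributing at most one vertex.\<close>
  define E where "E = (\<lambda>S :: 'a set. S \<times> S - Id)"
  have E: "finite (E S) \<and> card (E S) \<le> 9" if "S \<in> triangles (codegree_graph t G)" for S
  proof -
    have S: "card S = 3" using that by (simp add: triangles_def)
    then have "finite S" by (simp add: card_ge_0_finite)
    then show ?thesis
      using card_mono[of "S \<times> S" "E S"] S by (simp add: E_def card_cartesian_product)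
  qed
  let ?N = "\<lambda>e. common_nbrs G (fst e) (snd e)"
  have N: "pair_nbrs G S = (\<Union>e\<in>E S. ?N e)" for S
    unfolding set_eq_iff pair_nbrs_iff E_def UN_iff Bex_def split_paired_Ex by auto
  have "pair_nbrs G T \<inter> pair_nbrs G T' = (\<Union>p\<in>E T \<times> E T'. ?N (fst p) \<inter> ?N (snd p))"
    unfolding N by auto
  then have "card (pair_nbrs G T \<inter> pair_nbrs G T')
      \<le> (\<Sum>p\<in>E T \<times> E T'. card (?N (fst p) \<inter> ?N (snd p)))"
    using card_UN_le[of "E T \<times> E T'"] E[OF T(1)] E[OF T(2)] by simp
  also have "\<dots> \<le> (\<Sum>p\<in>E T \<times> E T'. 1)"
    by (intro sum_mono common_nbrs_Int[OF cf T]) (auto simp: E_def)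
  also have "\<dots> = card (E T) * card (E T')"
    by (simp add: card_cartesian_product)
  also have "\<dots> \<le> 9 * 9"
    using E[OF T(1)] E[OF T(2)] by (intro mult_le_mono) auto
  finally show ?thesis by simp
qed

section \<open>Counting triangles\<close>

lemma card_pair_nbrs_ge:
  assumes "T \<in> triangles (codegree_graph t G)"
  shows "t \<le> real (card (pair_nbrs G T))"
proof -
  have "card T = 3" using assms by (simp add: triangles_def)
  then obtain u v w where T: "T = {u, v, w}" "u \<noteq> v"
    unfolding card_3_iff by blast
  then have "t \<le> real (card (common_nbrs G u v))"
    using triangleD[OF assms, of u v] by (intro codegree_graph_le) simp
  also have "common_nbrs G u v \<subseteq> pair_nbrs G T"
    using T by (auto simp: pair_nbrs_def)
  then have "real (card (common_nbrs G u v)) \<le> real (card (pair_nbrs G T))"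
    using card_mono[OF finite_pair_nbrs] by simp
  finally show ?thesis .
qed

text \<open>The error term depends on the size of the family. The bound is thus used twice: for a
  subfamily of fixed size, to bound the number of triangles, and then for all triangles.\<close>

lemma sum_card_pair_nbrs_le:
  assumes "cycle_free 8 G" "8 \<le> t"
    and F: "F \<subseteq> triangles (codegree_graph t G)" "finite F"
  shows "(\<Sum>T\<in>F. card (pair_nbrs G T)) \<le> card (pverts G) + 81 * (card F)\<^sup>2"
proof -
  have "(\<Sum>T\<in>F. card (pair_nbrs G T)) \<le> card (\<Union>T\<in>F. pair_nbrs G T) + 81 * (card F)\<^sup>2"
    using F finite_pair_nbrs
    by (intro card_sum_le_card_Union pair_nbrs_Int[OF assms(1,2)]) auto
  also have "card (\<Union>T\<in>F. pair_nbrs G T) \<le> card (pverts G)"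
    using pair_nbrs_subset pair_finite_verts by (intro card_mono) auto
  finally show ?thesis by simp
qed

lemma finite_triangles: "finite (triangles (codegree_graph t G))"
proof (rule finite_subset)
  show "triangles (codegree_graph t G) \<subseteq> Pow (pverts G)"
    by (auto simp: triangles_def codegree_graph_def)
qed (simp add: pair_finite_verts)

lemma card_triangles_less:
  assumes "cycle_free 8 G" "8 \<le> t"
    and M: "2 * real (card (pverts G)) \<le> real M * t" and n: "81 * M\<^sup>2 < card (pverts G)"
  shows "card (triangles (codegree_graph t G)) < M"
proof (rule ccontr)
  assume "\<not> ?thesis"
  \<comment> \<open>Exactly \<open>M\<close> triangles are kept, so that the overlap error is
    \<open>81 * M\<^sup>2\<close>, which is less than the number of vertices.\<close>
  then obtain F where F: "F \<subseteq> triangles (codegree_graph t G)" "card F = M" "finite F"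
    using obtain_subset_with_card_n[of M "triangles (codegree_graph t G)"] by auto
  have "real M * t = (\<Sum>T\<in>F. t)" using F by simp
  also have "\<dots> \<le> (\<Sum>T\<in>F. real (card (pair_nbrs G T)))"
    using F(1) card_pair_nbrs_ge by (intro sum_mono) blast
  also have "\<dots> \<le> real (card (pverts G) + 81 * M\<^sup>2)"
    using sum_card_pair_nbrs_le[OF assms(1,2) F(1,3)] F(2)
    by (metis of_nat_mono of_nat_sum)
  also have "\<dots> < 2 * real (card (pverts G))"
    using n by linarith
  finally show False using M by simp
qed

end

theorem lemma2p4:
  fixes \<rho> :: real
  assumes "0 < \<rho>" and "\<rho> < 1"
  shows "\<exists>C::real. \<exists>n\<^sub>0::nat. \<forall>n\<ge>n\<^sub>0. \<forall>G :: 'a pair_pre_digraph.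
           pair_graph G \<and> card (pverts G) = n \<and> cycle_free 8 G \<longrightarrow>
           real (\<Sum>T\<in>triangles (codegree_graph (\<rho> * real n) G). card (pair_nbrs G T))
             \<le> real n + C"
proof -
  \<comment> \<open>With this choice, \<open>M\<close> sets of size at least
    \<open>\<rho> * n\<close> have total size at least \<open>2 * n\<close>.\<close>
  define M where "M = nat \<lceil>2 / \<rho>\<rceil>"
  have "2 / \<rho> \<le> real M"
    unfolding M_def by (rule real_nat_ceiling_ge)
  then have M: "2 \<le> real M * \<rho>"
    using assms(1) by (simp add: pos_divide_le_eq)
  \<comment> \<open>The first term ensures \<open>8 \<le> \<rho> * n\<close>, the second that the
    overlap error of \<open>M\<close> triangles stays below \<open>n\<close>.\<close>
  define n\<^sub>0 where "n\<^sub>0 = max (nat \<lceil>8 / \<rho>\<rceil>) (81 * M\<^sup>2 + 1)"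
  have "real (\<Sum>T\<in>triangles (codegree_graph (\<rho> * real n) G). card (pair_nbrs G T))
      \<le> real n + real (81 * M\<^sup>2)"
    if "n \<ge> n\<^sub>0" "pair_graph G" "card (pverts G) = n" "cycle_free 8 G"
    for n and G :: "'a pair_pre_digraph"
  proof -
    interpret pair_graph G by fact
    let ?\<T> = "triangles (codegree_graph (\<rho> * real n) G)"
    have "8 / \<rho> \<le> real n"
      using that(1) real_nat_ceiling_ge[of "8 / \<rho>"] by (simp add: n\<^sub>0_def)
    then have t: "8 \<le> \<rho> * real n"
      using assms(1) by (simp add: field_simps)
    have "2 * real n \<le> real M * (\<rho> * real n)"
      using mult_right_mono[OF M, of "real n"] by (simp add: mult.assoc)
    then have "card ?\<T> < M"
      using card_triangles_less[OF that(4) t, of M] that by (simp add: n\<^sub>0_def)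
    then have "(card ?\<T>)\<^sup>2 \<le> M\<^sup>2"
      by (simp add: power_mono)
    then have "(\<Sum>T\<in>?\<T>. card (pair_nbrs G T)) \<le> n + 81 * M\<^sup>2"
      using sum_card_pair_nbrs_le[OF that(4) t order_refl finite_triangles] that(3) by linarith
    then show ?thesis
      using of_nat_mono by fastforce
  qed
  then show ?thesis by blast
qed

end
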